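(* Define the integer sequence $v(n)$ by $v(n)=0$ for $n<0$ and, for all integers $n\geq 0$, \[ v(n) + \sum_{j\geq 1} (-1)^j\Big( v(n-j^2) + v(n-2j^2)\Big) = \begin{cases} 1 & \text{if } n=0,\\ 0 & \text{otherwise,}\end{cases} \] i.e. $v(n) - v(n-1) - v(n-2) + v(n-4) + v(n-8) - v(n-9) - v(n-18) + v(n-16) + \cdots$ equals $1$ if $n=0$ and $0$ otherwise. Then for every even $n\geq 0$, $v(n) = \overline{p}(n/2)$, and for every odd $n\geq 1$, $v(n) = \overline{p}_r((n-1)/2)$.
   Context: An overpartition of $m$ is a partition of $m$ in which the first occurrence of each part size may optionally be overlined (equivalently, a two-color partition where parts of the second, "overlined", color are distinct); $\overline{p}(m)$ denotes the number of overpartitions of $m$, with generating function $\sum_{m\geq0}\overline{p}(m)x^m=\prod_{k\geq1}\frac{1+x^k}{1-x^k}$. $\overline{p}_r(m)$ denotes the number of overpartitions of $m$ in which the overlined parts are either even (appearing in one color) or congruent to $1$ or $7$ modulo $8$ (each such size may appear overlined in two colors, each at most once); equivalently $\sum_{m\geq 0}\overline{p}_r(m)x^m = \prod_{k\geq1}\frac{(1+x^{2k})(1+x^{8k-1})^2(1+x^{8k-7})^2}{1-x^k}$. *)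

theory Defs
  imports Main "HOL-Library.Multiset"
begin

text \<open>An overpartition of m: a partition of m (multiset of positive parts summing to m)
  together with the set of part sizes whose first occurrence is overlined.\<close>
definition overpartitions :: "nat \<Rightarrow> (nat multiset \<times> nat set) set" where
  "overpartitions m = {(M, A). (\<forall>x\<in>#M. 0 < x) \<and> sum_mset M = m \<and> A \<subseteq> set_mset M}"

definition pbar :: "nat \<Rightarrow> nat" where
  "pbar m = card (overpartitions m)"

text \<open>Restricted overpartitions (two-colour description): ordinary parts M, overlined parts
  of the first colour A (distinct; even or congruent to 1 or 7 mod 8), overlined parts of the
  second colour B (distinct; congruent to 1 or 7 mod 8).\<close>
definition overpartitions_r :: "nat \<Rightarrow> (nat multiset \<times> nat set \<times> nat set) set" where
  "overpartitions_r m = {(M, A, B). (\<forall>x\<in>#M. 0 < x) \<and> finite A \<and> finite B \<and>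
      (\<forall>x\<in>A. 0 < x \<and> (even x \<or> x mod 8 = 1 \<or> x mod 8 = 7)) \<and>
      (\<forall>x\<in>B. x mod 8 = 1 \<or> x mod 8 = 7) \<and>
      sum_mset M + \<Sum>A + \<Sum>B = m}"

definition pbar_r :: "nat \<Rightarrow> nat" where
  "pbar_r m = card (overpartitions_r m)"

end

theory Submission
  imports Defs "HOL-Computational_Algebra.Formal_Power_Series"
begin

text \<open>
  Write \<open>\<phi>(q) = \<Sum>j. q^(j^2)\<close> over all integers \<open>j\<close> and \<open>\<psi>(q) = \<Sum>j. q^(2j^2 - j)\<close>. The recursion says
  \<open>V(q) (\<phi>(-q) + \<phi>(-q^2)) = 2\<close> for the generating function \<open>V\<close> of \<open>v\<close>. With \<open>A = \<phi>(-q)\<close>,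
  \<open>B = \<phi>(-q^2)\<close>, \<open>C = \<phi>(q^4)\<close>, the generating function of \<open>pbar\<close> at \<open>q^2\<close> is \<open>1/B\<close> by Gauss's product
  for \<open>\<phi>\<close>, and that of \<open>pbar_r\<close> at \<open>q^2\<close> is \<open>(C - B) / (2 q^2 \<psi>(q^8) B)\<close>. Since
  \<open>C - A = 2 q \<psi>(q^8)\<close> and \<open>A (2C - A) = \<phi>(-q) \<phi>(q) = B^2\<close>, the combination of the even and the odd
  part multiplied by \<open>A + B\<close> is 2. The value of \<open>C - B\<close> comes from
  \<open>\<psi>(x) (\<phi>(x^2) - \<phi>(-x)) = 2 x (\<Sum>j. x^(4j^2 - 3j))^2\<close> at \<open>x = q^2\<close>: a parity argument on the double
  sum shows this with \<open>\<psi>(-x) \<phi>(-x^2)\<close> in place of \<open>\<psi>(x) \<phi>(-x)\<close>, and the two products agree by the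
  Jacobi triple product.
\<close>

section \<open>Graded sums\<close>

text \<open>Exponents are integer-valued so that quadratic polynomials in integer indices can be
  handled without truncated subtraction.\<close>

definition gser :: "'i set \<Rightarrow> ('i \<Rightarrow> int) \<Rightarrow> ('i \<Rightarrow> int) \<Rightarrow> int fps" where
  "gser I w e = Abs_fps (\<lambda>n. \<Sum>i | i \<in> I \<and> e i = int n. w i)"

text \<open>Without finite fibres the coefficient sums of \<^const>\<open>gser\<close> would silently be 0.\<close>

definition graded :: "'i set \<Rightarrow> ('i \<Rightarrow> int) \<Rightarrow> bool" where
  "graded I e \<longleftrightarrow> (\<forall>i\<in>I. 0 \<le> e i) \<and> (\<forall>n. finite {i. i \<in> I \<and> e i = int n})"

lemma gser_nth: "fps_nth (gser I w e) n = (\<Sum>i | i \<in> I \<and> e i = int n. w i)"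
  by (simp add: gser_def)

lemma gradedD:
  assumes "graded I e"
  shows "i \<in> I \<Longrightarrow> 0 \<le> e i" and "finite {i. i \<in> I \<and> e i = int n}"
  using assms by (auto simp: graded_def)

lemma graded_subset: "graded I e \<Longrightarrow> J \<subseteq> I \<Longrightarrow> graded J e"
  unfolding graded_def
  by (auto intro: finite_subset[of "{i. i \<in> J \<and> e i = int n}" "{i. i \<in> I \<and> e i = int n}" for n])

lemma graded_finite_atMost:
  assumes "graded I e"
  shows "finite {i. i \<in> I \<and> e i \<le> int n}"
proof (rule finite_subset)
  show "{i. i \<in> I \<and> e i \<le> int n} \<subseteq> (\<Union>k\<in>{..n}. {i. i \<in> I \<and> e i = int k})"
  proof
    fix i assume "i \<in> {i. i \<in> I \<and> e i \<le> int n}"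
    then have "i \<in> I" "e i = int (nat (e i))" "nat (e i) \<le> n"
      using gradedD(1)[OF assms] by auto
    then show "i \<in> (\<Union>k\<in>{..n}. {i. i \<in> I \<and> e i = int k})" by blast
  qed
qed (use gradedD(2)[OF assms] in auto)

text \<open>Multiplying by a graded sum takes a weighted sum of index shifts. In this form the
  recursion for \<open>v\<close> turns into a product of series.\<close>

lemma fps_mult_gser_nth:
  assumes "graded I e"
  shows "fps_nth (f * gser I w e) n
    = (\<Sum>i | i \<in> I \<and> e i \<le> int n. w i * fps_nth f (n - nat (e i)))"
proof -
  have "fps_nth (f * gser I w e) n = fps_nth (gser I w e * f) n"
    by (simp add: mult.commute)
  also have "\<dots> = (\<Sum>k=0..n. \<Sum>i | i \<in> I \<and> e i = int k. w i * fps_nth f (n - k))"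
    by (simp add: fps_mult_nth gser_nth sum_distrib_right)
  also have "\<dots> = (\<Sum>(k,i)\<in>(SIGMA k:{0..n}. {i. i \<in> I \<and> e i = int k}). w i * fps_nth f (n - k))"
    by (rule sum.Sigma) (use gradedD(2)[OF assms] in auto)
  also have "\<dots> = (\<Sum>i | i \<in> I \<and> e i \<le> int n. w i * fps_nth f (n - nat (e i)))"
    by (rule sum.reindex_bij_witness[of _ "\<lambda>i. (nat (e i), i)" snd])
       (use gradedD(1)[OF assms] in auto)
  finally show ?thesis .
qed

text \<open>Products of theta series become sums over index pairs, where parity arguments and linear
  changes of variables apply.\<close>

lemma gser_mult:
  assumes "graded I e" "graded J d"
  shows "gser I v e * gser J w d = gser (I \<times> J) (\<lambda>(i,j). v i * w j) (\<lambda>(i,j). e i + d j)"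
proof (rule fps_ext)
  fix n
  have total: "d j \<le> int n \<and> e i = int (n - nat (d j))"
    if "i \<in> I" "j \<in> J" "e i + d j = int n" for i j
    using that gradedD(1)[OF assms(1), of i] gradedD(1)[OF assms(2), of j] by auto
  have "fps_nth (gser I v e * gser J w d) n
    = (\<Sum>j | j \<in> J \<and> d j \<le> int n. \<Sum>i | i \<in> I \<and> e i = int (n - nat (d j)). v i * w j)"
    by (simp add: fps_mult_gser_nth[OF assms(2)] gser_nth sum_distrib_left mult.commute)
  also have "\<dots> = (\<Sum>(j,i)\<in>(SIGMA j:{j. j \<in> J \<and> d j \<le> int n}. {i. i \<in> I \<and> e i = int (n - nat (d j))}). v i * w j)"
    by (rule sum.Sigma) (use gradedD(2)[OF assms(1)] graded_finite_atMost[OF assms(2)] in auto)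
  also have "\<dots> = (\<Sum>p | p \<in> I \<times> J \<and> (case p of (i,j) \<Rightarrow> e i + d j) = int n. case p of (i,j) \<Rightarrow> v i * w j)"
    by (rule sum.reindex_bij_witness[of _ "\<lambda>(i,j). (j,i)" "\<lambda>(j,i). (i,j)"])
       (use gradedD(1)[OF assms(2)] total in auto)
  finally show "fps_nth (gser I v e * gser J w d) n
    = fps_nth (gser (I \<times> J) (\<lambda>(i,j). v i * w j) (\<lambda>(i,j). e i + d j)) n"
    by (simp add: gser_nth)
qed

lemma graded_Times:
  assumes "graded I e" "graded J d"
  shows "graded (I \<times> J) (\<lambda>(i,j). e i + d j)"
  unfolding graded_def
proof (intro conjI allI ballI)
  fix n
  have "{p. p \<in> I \<times> J \<and> (case p of (i,j) \<Rightarrow> e i + d j) = int n}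
      \<subseteq> {i. i \<in> I \<and> e i \<le> int n} \<times> {j. j \<in> J \<and> d j \<le> int n}"
    using gradedD(1)[OF assms(1)] gradedD(1)[OF assms(2)] by force
  then show "finite {p. p \<in> I \<times> J \<and> (case p of (i,j) \<Rightarrow> e i + d j) = int n}"
    by (rule finite_subset) (simp add: graded_finite_atMost assms)
qed (use gradedD(1)[OF assms(1)] gradedD(1)[OF assms(2)] in force)

lemma gser_reindex:
  assumes "bij_betw h J I" "\<And>j. j \<in> J \<Longrightarrow> e (h j) = d j" "\<And>j. j \<in> J \<Longrightarrow> w (h j) = v j"
  shows "gser I w e = gser J v d"
proof (rule fps_ext)
  fix n
  have "(\<Sum>i | i \<in> I \<and> e i = int n. w i) = (\<Sum>j | j \<in> J \<and> d j = int n. w (h j))"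
  proof (rule sum.reindex_bij_betw[symmetric])
    show "bij_betw h {j. j \<in> J \<and> d j = int n} {i. i \<in> I \<and> e i = int n}"
      using assms(1,2) unfolding bij_betw_def inj_on_def by (auto simp: image_iff)
  qed
  also have "\<dots> = (\<Sum>j | j \<in> J \<and> d j = int n. v j)"
    by (rule sum.cong) (auto simp: assms(3))
  finally show "fps_nth (gser I w e) n = fps_nth (gser J v d) n"
    by (simp add: gser_nth)
qed

lemma gser_cong:
  assumes "\<And>i. i \<in> I \<Longrightarrow> w i = v i" "\<And>i. i \<in> I \<Longrightarrow> e i = d i"
  shows "gser I w e = gser I v d"
  by (rule gser_reindex[of id]) (auto simp: assms)

lemma gser_restrict:
  assumes "graded I e" "J \<subseteq> I" "\<And>i. i \<in> I \<Longrightarrow> i \<notin> J \<Longrightarrow> w i = 0"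
  shows "gser I w e = gser J w e"
proof (rule fps_ext)
  fix n
  show "fps_nth (gser I w e) n = fps_nth (gser J w e) n"
    unfolding gser_nth
    by (rule sum.mono_neutral_right) (use assms gradedD(2)[OF assms(1)] in auto)
qed

lemma gser_Un:
  assumes "graded (I \<union> J) e" "I \<inter> J = {}"
  shows "gser (I \<union> J) w e = gser I w e + gser J w e"
proof (rule fps_ext)
  fix n
  have "{i. i \<in> I \<union> J \<and> e i = int n} = {i. i \<in> I \<and> e i = int n} \<union> {i. i \<in> J \<and> e i = int n}"
    by auto
  moreover have "finite {i. i \<in> I \<and> e i = int n}" "finite {i. i \<in> J \<and> e i = int n}"
    using assms(1) graded_subset gradedD(2) by (metis Un_upper1, metis Un_upper2)
  ultimately show "fps_nth (gser (I \<union> J) w e) n = fps_nth (gser I w e + gser J w e) n"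
    unfolding gser_nth fps_add_nth using assms(2) by (subst sum.union_disjoint[symmetric]) auto
qed

lemma gser_add: "gser I w e + gser I v e = gser I (\<lambda>i. w i + v i) e"
  and gser_diff: "gser I w e - gser I v e = gser I (\<lambda>i. w i - v i) e"
  by (rule fps_ext, simp add: gser_nth sum.distrib sum_subtractf)+

lemma gser_const_mult: "fps_const c * gser I w e = gser I (\<lambda>i. c * w i) e"
  by (rule fps_ext) (simp add: gser_nth sum_distrib_left)

lemma gser_numeral_mult: "numeral c * gser I w e = gser I (\<lambda>i. numeral c * w i) e"
  unfolding numeral_fps_const by (rule gser_const_mult)

lemma fps_X_power_gser:
  assumes "graded I e"
  shows "fps_X ^ m * gser I w e = gser I w (\<lambda>i. int m + e i)"
proof (rule fps_ext)
  fix n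
  have "{i. i \<in> I \<and> int m + e i = int n} = (if n < m then {} else {i. i \<in> I \<and> e i = int (n - m)})"
    using gradedD(1)[OF assms] by force
  then show "fps_nth (fps_X ^ m * gser I w e) n = fps_nth (gser I w (\<lambda>i. int m + e i)) n"
    by (simp add: fps_X_power_mult_nth gser_nth)
qed

lemma gser_singleton: "0 \<le> e a \<Longrightarrow> gser {a} w e = fps_const (w a) * fps_X ^ nat (e a)"
proof (rule fps_ext)
  fix n assume "0 \<le> e a"
  then have "{i. i \<in> {a} \<and> e i = int n} = (if n = nat (e a) then {a} else {})"
    by auto
  then show "fps_nth (gser {a} w e) n = fps_nth (fps_const (w a) * fps_X ^ nat (e a)) n"
    by (simp add: gser_nth)
qed

lemma gradedI_abs:
  assumes "\<And>n::int. \<bar>n\<bar> \<le> e n"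
  shows "graded UNIV e"
  unfolding graded_def
proof (intro conjI allI ballI)
  fix n
  have "{i. i \<in> UNIV \<and> e i = int n} \<subseteq> {- int n..int n}"
    using assms by (smt (verit) abs_le_iff atLeastAtMost_iff mem_Collect_eq subsetI)
  then show "finite {i. i \<in> UNIV \<and> e i = int n}"
    using finite_subset by blast
next
  fix i show "0 \<le> e i" using assms[of i] by linarith
qed

section \<open>Products over sets of exponents\<close>

text \<open>The infinite product of \<open>1 + s * x^k\<close> over \<open>k \<in> S\<close>,
  encoded without a limit: factors with \<open>k > n\<close> are 1 modulo x^(n+1) and cannot affect
  coefficient \<open>n\<close>.\<close>

definition qprod :: "int \<Rightarrow> nat set \<Rightarrow> int fps" where
  "qprod s S = Abs_fps (\<lambda>n. fps_nth (\<Prod>k\<in>S \<inter> {..n}. 1 + fps_const s * fps_X ^ k) n)"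

section \<open>Congruences modulo powers of the variable\<close>

lemma X_dvd_imp_nth_eq:
  assumes "fps_X ^ Suc n dvd f - (g :: int fps)" "m \<le> n"
  shows "fps_nth f m = fps_nth g m"
proof -
  obtain h where "f - g = fps_X ^ Suc n * h" using assms(1) by (auto elim: dvdE)
  then have "fps_nth (f - g) m = 0"
    using assms(2) by (simp add: fps_X_power_mult_nth del: power_Suc)
  then show ?thesis by simp
qed

lemma nth_eq_imp_X_dvd:
  assumes "\<And>m. m \<le> n \<Longrightarrow> fps_nth f m = fps_nth (g :: int fps) m"
  shows "fps_X ^ Suc n dvd f - g"
proof -
  have "f - g = fps_X ^ Suc n * fps_shift (Suc n) (f - g)"
    by (rule fps_ext) (use assms in \<open>simp add: fps_X_power_mult_nth del: power_Suc\<close>)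
  then show ?thesis by (rule dvdI)
qed

lemma prod_X_dvd:
  assumes "finite T" "\<And>k. k \<in> T \<Longrightarrow> n < k"
  shows "fps_X ^ Suc n dvd (\<Prod>k\<in>T. 1 + fps_const s * fps_X ^ k) - (1 :: int fps)"
  using assms
proof (induction T rule: finite_induct)
  case (insert k T)
  let ?p = "\<Prod>k\<in>T. 1 + fps_const s * fps_X ^ k :: int fps"
  have "fps_X ^ Suc n dvd (fps_X ^ k :: int fps)"
    using insert.prems[of k] by (intro le_imp_power_dvd) auto
  then have "fps_X ^ Suc n dvd (?p - 1) + fps_X ^ k * (fps_const s * ?p)"
    using insert by (intro dvd_add dvd_mult2) auto
  then show ?case using insert by (simp add: algebra_simps)
qed simp

text \<open>The extra factors of \<open>T\<close> all have \<open>k > n\<close>, so they multiply to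
  1 modulo x^(n+1). Each application may thus choose a convenient finite truncation.\<close>

lemma qprod_nth:
  assumes "finite T" "S \<inter> {..n} \<subseteq> T" "T \<subseteq> S"
  shows "fps_nth (qprod s S) n = fps_nth (\<Prod>k\<in>T. 1 + fps_const s * fps_X ^ k) n"
proof -
  let ?f = "\<lambda>k. 1 + fps_const s * fps_X ^ k :: int fps"
  have "prod ?f T = prod ?f (T - S \<inter> {..n}) * prod ?f (S \<inter> {..n})"
    using assms by (simp add: prod.subset_diff)
  then have "prod ?f T - prod ?f (S \<inter> {..n}) = (prod ?f (T - S \<inter> {..n}) - 1) * prod ?f (S \<inter> {..n})"
    by (simp add: algebra_simps)
  moreover have "fps_X ^ Suc n dvd prod ?f (T - S \<inter> {..n}) - 1"
    using assms by (intro prod_X_dvd) auto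
  ultimately have "fps_X ^ Suc n dvd prod ?f T - prod ?f (S \<inter> {..n})"
    by (metis dvd_mult2)
  then show ?thesis unfolding qprod_def using X_dvd_imp_nth_eq by fastforce
qed

lemma qprod_X_dvd:
  assumes "finite T" "S \<inter> {..n} \<subseteq> T" "T \<subseteq> S"
  shows "fps_X ^ Suc n dvd qprod s S - (\<Prod>k\<in>T. 1 + fps_const s * fps_X ^ k)"
  by (intro nth_eq_imp_X_dvd qprod_nth) (use assms in auto)

lemma fps_eqI_X_dvd:
  assumes "\<And>n. fps_X ^ Suc n dvd f - (g :: int fps)"
  shows "f = g"
  using X_dvd_imp_nth_eq[OF assms] by (intro fps_ext) blast

lemma X_dvd_mult_cong:
  assumes "d dvd f - f'" "d dvd g - (g' :: int fps)"
  shows "d dvd f * g - f' * g'"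
proof -
  have "f * g - f' * g' = (f - f') * g + f' * (g - g')" by (simp add: algebra_simps)
  then show ?thesis using assms by simp
qed

lemma X_dvd_common: "d dvd f - h \<Longrightarrow> d dvd g - h \<Longrightarrow> d dvd f - (g :: int fps)"
  using dvd_diff[of d "f - h" "g - h"] by simp

lemma qprod_mult_disjoint:
  assumes "S \<inter> T = {}"
  shows "qprod s S * qprod s T = qprod s (S \<union> T)"
proof (rule fps_eqI_X_dvd)
  fix n
  let ?f = "\<lambda>k. 1 + fps_const s * fps_X ^ k :: int fps"
  have "fps_X ^ Suc n dvd qprod s S * qprod s T - prod ?f (S \<inter> {..n}) * prod ?f (T \<inter> {..n})"
    by (intro X_dvd_mult_cong qprod_X_dvd) auto
  moreover have "prod ?f (S \<inter> {..n}) * prod ?f (T \<inter> {..n}) = prod ?f ((S \<union> T) \<inter> {..n})"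
    using assms by (subst prod.union_disjoint[symmetric]) (auto simp: Int_Un_distrib2)
  moreover have "fps_X ^ Suc n dvd qprod s (S \<union> T) - prod ?f ((S \<union> T) \<inter> {..n})"
    by (intro qprod_X_dvd) auto
  ultimately show "fps_X ^ Suc n dvd qprod s S * qprod s T - qprod s (S \<union> T)"
    by (metis X_dvd_common)
qed

text \<open>Factor by factor this is (1 + x^k)(1 - x^k) = 1 - x^(2k).\<close>

lemma qprod_plus_minus: "qprod 1 S * qprod (-1) S = qprod (-1) ((*) 2 ` S)"
proof (rule fps_eqI_X_dvd)
  fix n
  let ?f = "\<lambda>s k. 1 + fps_const s * fps_X ^ k :: int fps"
  have "fps_X ^ Suc n dvd qprod 1 S * qprod (-1) S - prod (?f 1) (S \<inter> {..n}) * prod (?f (-1)) (S \<inter> {..n})"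
    by (intro X_dvd_mult_cong qprod_X_dvd) auto
  moreover have "prod (?f 1) (S \<inter> {..n}) * prod (?f (-1)) (S \<inter> {..n}) = prod (?f (-1)) ((*) 2 ` (S \<inter> {..n}))"
    by (subst prod.reindex)
       (auto simp: inj_on_def algebra_simps mult_2_right power_add simp flip: prod.distrib fps_const_neg)
  moreover have "fps_X ^ Suc n dvd qprod (-1) ((*) 2 ` S) - prod (?f (-1)) ((*) 2 ` (S \<inter> {..n}))"
    by (intro qprod_X_dvd) auto
  ultimately show "fps_X ^ Suc n dvd qprod 1 S * qprod (-1) S - qprod (-1) ((*) 2 ` S)"
    by (metis X_dvd_common)
qed

lemma fps_nth_compose_X2:
  "fps_nth (fps_compose f (fps_X ^ 2)) n = (if even n then fps_nth f (n div 2) else (0 :: int))"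
proof -
  have "fps_nth (fps_compose f (fps_X ^ 2)) n = (\<Sum>i=0..n. if n = 2 * i then fps_nth f i else 0)"
    unfolding fps_compose_nth by (intro sum.cong) (auto simp: fps_X_power_nth simp flip: power_mult)
  also have "\<dots> = (\<Sum>i=0..n. if i = n div 2 then if even n then fps_nth f i else 0 else 0)"
    by (intro sum.cong) auto
  finally show ?thesis by simp
qed

text \<open>Serves to carry the product formulas for \<open>pbar\<close> and \<open>pbar_r\<close>
  over to the even-indexed and odd-indexed parts of \<open>v\<close>.\<close>

lemma qprod_compose_X2: "fps_compose (qprod s S) (fps_X ^ 2) = qprod s ((*) 2 ` S)"
proof (rule fps_ext)
  fix n
  let ?f = "\<lambda>k. 1 + fps_const s * fps_X ^ k :: int fps"
  have "fps_nth (qprod s ((*) 2 ` S)) n = fps_nth (\<Prod>k\<in>(*) 2 ` (S \<inter> {..n}). ?f k) n"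
    by (rule qprod_nth) auto
  also have "(\<Prod>k\<in>(*) 2 ` (S \<inter> {..n}). ?f k) = (\<Prod>k\<in>S \<inter> {..n}. ?f (2 * k))"
    by (subst prod.reindex) (auto simp: inj_on_def)
  also have "\<dots> = fps_compose (\<Prod>k\<in>S \<inter> {..n}. ?f k) (fps_X ^ 2)"
    by (subst fps_compose_prod_distrib)
       (auto simp: fps_compose_add_distrib fps_compose_mult_distrib fps_compose_power[symmetric] power_mult intro!: prod.cong)
  also have "fps_nth \<dots> n = fps_nth (fps_compose (qprod s S) (fps_X ^ 2)) n"
    by (auto simp: fps_nth_compose_X2 intro!: qprod_nth[symmetric])
  finally show "fps_nth (fps_compose (qprod s S) (fps_X ^ 2)) n = fps_nth (qprod s ((*) 2 ` S)) n" ..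
qed

lemma qprod_nonzero:
  assumes "0 \<notin> S"
  shows "fps_nth (qprod s S) 0 = 1" "qprod s S \<noteq> 0"
proof -
  show *: "fps_nth (qprod s S) 0 = 1"
    using assms by (subst qprod_nth[where T="{}"]) auto
  show "qprod s S \<noteq> 0" using * by auto
qed

section \<open>The Jacobi triple product\<close>

text \<open>Given by the q-Pascal rule instead of a quotient of q-factorials, so that it makes sense
  in every commutative ring.\<close>

fun gauss_binomial :: "'a::comm_ring_1 \<Rightarrow> nat \<Rightarrow> nat \<Rightarrow> 'a" where
  "gauss_binomial q n 0 = 1"
| "gauss_binomial q 0 (Suc k) = 0"
| "gauss_binomial q (Suc n) (Suc k) = q ^ Suc k * gauss_binomial q n (Suc k) + gauss_binomial q n k"

definition qfact :: "'a::comm_ring_1 \<Rightarrow> nat \<Rightarrow> 'a" where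
  "qfact q n = (\<Prod>k\<in>{1..n}. 1 - q ^ k)"

lemma qfact_0 [simp]: "qfact q 0 = 1"
  and qfact_Suc: "qfact q (Suc n) = qfact q n * (1 - q ^ Suc n)"
  by (simp_all add: qfact_def prod.nat_ivl_Suc' mult.commute)

lemma gauss_binomial_eq_0: "n < k \<Longrightarrow> gauss_binomial q n k = 0"
  by (induction q n k rule: gauss_binomial.induct) auto

lemma gauss_binomial_self: "gauss_binomial q n n = 1"
  by (induction n) (auto simp: gauss_binomial_eq_0)

text \<open>The quotient formula with denominators cleared. The two terms of the q-Pascal rule are
  evaluated by induction on \<open>a + b\<close> and recombine because q^a (1 - q^b) + (1 - q^a) = 1
  - q^(a+b).\<close>

lemma gauss_binomial_qfact: "gauss_binomial q (a + b) a * qfact q a * qfact q b = qfact q (a + b)"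
proof (induction "a + b" arbitrary: a b)
  case (Suc n)
  show ?case
  proof (cases a)
    case (Suc a')
    show ?thesis
    proof (cases b)
      case (Suc b')
      have IH1: "gauss_binomial q (a + b') a * qfact q a * qfact q b' = qfact q (a + b')"
        using Suc.hyps Suc by auto
      have IH2: "gauss_binomial q (a' + b) a' * qfact q a' * qfact q b = qfact q (a' + b)"
        using Suc.hyps \<open>a = Suc a'\<close> by auto
      have "gauss_binomial q (a + b) a * qfact q a * qfact q b
        = q ^ a * (1 - q ^ b) * (gauss_binomial q (a + b') a * qfact q a * qfact q b')
          + (1 - q ^ a) * (gauss_binomial q (a' + b) a' * qfact q a' * qfact q b)"
        by (simp add: \<open>a = Suc a'\<close> Suc qfact_Suc algebra_simps)
      also have "\<dots> = (q ^ a * (1 - q ^ b) + (1 - q ^ a)) * qfact q (a' + b)"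
        unfolding IH1 IH2 by (simp add: \<open>a = Suc a'\<close> Suc algebra_simps)
      also have "\<dots> = qfact q (a + b)"
        by (simp add: \<open>a = Suc a'\<close> qfact_Suc algebra_simps power_add)
      finally show ?thesis .
    qed (simp add: gauss_binomial_self)
  qed simp
qed simp

text \<open>The binomial theorem is stated homogeneously because its use below takes \<open>u\<close> to be a positive
  power of the formal variable in place of the negative powers in the triple product.\<close>

lemma q_binomial:
  "(\<Prod>k<m. u + v * q ^ k) = (\<Sum>i\<le>m. gauss_binomial q m i * q ^ (i choose 2) * v ^ i * u ^ (m - i))"
proof (induction m arbitrary: v)
  case (Suc m)
  define c where "c i = gauss_binomial q m i * q ^ (i choose 2) * q ^ i" for i
  have choose: "Suc i choose 2 = i + (i choose 2)" for i
    by (simp add: numeral_2_eq_2)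
  have zero: "0 choose 2 = 0"
    by (rule binomial_eq_0) simp
  have first: "gauss_binomial q (Suc m) 0 * q ^ (0 choose 2) * w ^ 0 * u ^ (Suc m - 0) = u ^ Suc m" for w
    unfolding zero by simp
  \<comment> \<open>Splitting off the factor at \<open>k = 0\<close> replaces \<open>v\<close> by
    \<open>v * q\<close> in the remaining ones, hence the induction with \<open>v\<close>
    arbitrary.\<close>
  have "(\<Prod>k<Suc m. u + v * q ^ k) = (u + v) * (\<Prod>k<m. u + (v * q) * q ^ k)"
    by (simp add: prod.lessThan_Suc_shift mult_ac del: prod.lessThan_Suc)
  also have "\<dots> = (u + v) * (\<Sum>i\<le>m. c i * v ^ i * u ^ (m - i))"
    unfolding Suc.IH by (simp add: c_def power_mult_distrib mult_ac)
  also have "\<dots> = (\<Sum>i\<le>m. c i * v ^ i * u ^ (Suc m - i)) + (\<Sum>i\<le>m. c i * v ^ Suc i * u ^ (m - i))"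
    by (simp add: distrib_right sum_distrib_left Suc_diff_le mult_ac sum.distrib[symmetric] distrib_left)
  \<comment> \<open>The added term at \<open>Suc m\<close> vanishes. After an index shift,
    \<open>c (Suc i)\<close> meets \<open>c i\<close>, and their sum is an instance of the q-Pascal
    rule.\<close>
  also have "(\<Sum>i\<le>m. c i * v ^ i * u ^ (Suc m - i)) = (\<Sum>i\<le>Suc m. c i * v ^ i * u ^ (Suc m - i))"
    by (simp add: c_def gauss_binomial_eq_0)
  also have "\<dots> = u ^ Suc m + (\<Sum>i\<le>m. c (Suc i) * v ^ Suc i * u ^ (m - i))"
    by (subst sum.atMost_Suc_shift) (simp add: c_def zero)
  also have "\<dots> + (\<Sum>i\<le>m. c i * v ^ Suc i * u ^ (m - i))
    = u ^ Suc m + (\<Sum>i\<le>m. (c (Suc i) + c i) * v ^ Suc i * u ^ (m - i))"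
    by (simp add: distrib_right sum.distrib)
  also have "\<dots> = (\<Sum>i\<le>Suc m. gauss_binomial q (Suc m) i * q ^ (i choose 2) * v ^ i * u ^ (Suc m - i))"
    unfolding sum.atMost_Suc_shift first by (simp add: c_def choose power_add algebra_simps)
  finally show ?case .
qed (simp add: binomial_eq_0)

text \<open>Equals a j(j-1)/2 + b j(j+1)/2, the exponent in Ramanujan's general theta function
  f(x^a, x^b); the division by 2 is exact.\<close>

definition theta_exp :: "nat \<Rightarrow> nat \<Rightarrow> int \<Rightarrow> int" where
  "theta_exp a b j = int (a + b) * (j * (j - 1) div 2) + int b * j"

lemma theta_exp_double: "2 * theta_exp a b j = int (a + b) * (j * (j - 1)) + 2 * int b * j"
  by (simp add: theta_exp_def algebra_simps)

text \<open>This bound makes theta series graded and limits the relevant indices in the triple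
  product. For negative \<open>j\<close> the exponent is rewritten with \<open>a\<close> in the
  linear term, which makes both summands nonnegative.\<close>

lemma theta_exp_ge:
  assumes "0 < a" "0 < b"
  shows "\<bar>j\<bar> \<le> theta_exp a b j"
proof (cases "0 \<le> j")
  case True
  have "0 \<le> int (a + b) * (j * (j - 1) div 2)"
    using True by (cases "j = 0") auto
  moreover have "1 * j \<le> int b * j" using True assms by (intro mult_right_mono) auto
  ultimately show ?thesis using True by (simp add: theta_exp_def)
next
  case False
  have "0 \<le> int (a + b) * (j * (j + 1))" using False by (intro mult_nonneg_nonneg mult_nonpos_nonpos) auto
  moreover have "1 * (- j) \<le> int a * (- j)" using False assms by (intro mult_right_mono) auto
  moreover have "2 * theta_exp a b j = int (a + b) * (j * (j + 1)) + 2 * (int a * (- j))"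
    unfolding theta_exp_double by (simp add: algebra_simps)
  ultimately show ?thesis using False by linarith
qed

lemma graded_theta: "0 < a \<Longrightarrow> 0 < b \<Longrightarrow> graded UNIV (theta_exp a b)"
  by (intro gradedI_abs theta_exp_ge)

lemma sign_power_parity:
  assumes "s * s = (1 :: int)" "even (p + q)"
  shows "s ^ p = s ^ q"
proof -
  have "s = 1 \<or> s = -1" using assms(1) by (simp add: zmult_eq_1_iff)
  then show ?thesis using assms(2) by (auto simp: minus_one_power_iff)
qed

lemma choose_two_int: "2 * int (n choose 2) = int n * (int n - 1)"
  by (induction n) (simp_all add: numeral_2_eq_2 algebra_simps)

lemma prod_lessThan_add: "(\<Prod>k<n + m. f k) = (\<Prod>k<n. f k) * (\<Prod>k<m. f (n + k))"
  for f :: "nat \<Rightarrow> 'a::comm_monoid_mult"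
  by (induction m) (simp_all add: mult_ac)

text \<open>A series with constant term 1 is invertible already over the integers, so it can be
  cancelled.\<close>

lemma dvd_mult_fps_unitD:
  fixes g h :: "int fps"
  assumes "d dvd g * h" "fps_nth g 0 = 1"
  shows "d dvd h"
proof -
  have "fps_right_inverse g 1 * (g * h) = h"
    using fps_right_inverse[of g 1] assms(2) by (metis mult.assoc mult.commute mult_1)
  then show ?thesis using assms(1) by (metis dvd_mult)
qed

text \<open>This is \<open>q_binomial\<close> with 2n factors, q = x^(a+b), v = s x^b and u =
  x^((a+b)n). Taking u out of the upper n factors leaves the progression from \<open>b\<close>;
  taking v q^k out of the lower n leaves the one from \<open>a\<close>. Cancelling the common
  monomial centres the sum at i = n.\<close>

lemma finite_jacobi_triple_product:
  fixes s :: int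
  assumes s: "s * s = 1" and ab: "0 < a" "0 < b"
  shows "(\<Prod>k<n. 1 + fps_const s * fps_X ^ ((a + b) * k + b)) * (\<Prod>k<n. 1 + fps_const s * fps_X ^ ((a + b) * k + a))
    = (\<Sum>i\<le>2 * n. gauss_binomial (fps_X ^ (a + b)) (2 * n) i * (fps_const (s ^ nat \<bar>int i - int n\<bar>)
        * fps_X ^ nat (theta_exp a b (int i - int n))))"
    (is "?PB * ?PA = ?R")
proof -
  define c where "c = a + b"
  \<comment> \<open>The total power of x taken out: c n^2 from the upper factors, b n + c (n choose
    2) from the lower ones.\<close>
  define M where "M = c * n * n + b * n + c * (n choose 2)"
  define S :: "int fps" where "S = fps_const s"
  let ?X = "fps_X :: int fps"
  have SS: "S * S = 1" using s by (simp add: S_def)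
  have "(\<Prod>k<2 * n. ?X ^ (c * n) + (S * ?X ^ b) * (?X ^ c) ^ k)
    = (\<Prod>k<n. ?X ^ (c * n) + (S * ?X ^ b) * (?X ^ c) ^ k) * (\<Prod>k<n. ?X ^ (c * n) + (S * ?X ^ b) * (?X ^ c) ^ (n + k))"
    unfolding mult_2 by (rule prod_lessThan_add)
  also have "(\<Prod>k<n. ?X ^ (c * n) + (S * ?X ^ b) * (?X ^ c) ^ (n + k)) = (\<Prod>k<n. ?X ^ (c * n) * (1 + S * ?X ^ (c * k + b)))"
    by (intro prod.cong) (simp_all add: algebra_simps power_add flip: power_mult)
  also have "\<dots> = ?X ^ (c * n * n) * ?PB"
    by (simp add: prod.distrib S_def c_def flip: power_mult)
  also have "(\<Prod>k<n. ?X ^ (c * n) + (S * ?X ^ b) * (?X ^ c) ^ k)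
    = (\<Prod>k<n. (S * ?X ^ b) * (?X ^ c) ^ k * (1 + S * ?X ^ (c * (n - Suc k) + a)))"
  proof (intro prod.cong refl)
    fix k assume "k \<in> {..<n}"
    then obtain d where n: "n = Suc (k + d)" using less_imp_Suc_add by auto
    \<comment> \<open>Since the sign squares to 1, u is a multiple of v q^k for every
      \<open>k < n\<close>.\<close>
    have "?X ^ (c * n) = (S * S) * (?X ^ b * ?X ^ (c * k) * ?X ^ (c * (n - Suc k) + a))"
      unfolding SS by (simp add: n c_def algebra_simps flip: power_add)
    then show "?X ^ (c * n) + (S * ?X ^ b) * (?X ^ c) ^ k = (S * ?X ^ b) * (?X ^ c) ^ k * (1 + S * ?X ^ (c * (n - Suc k) + a))"
      by (simp add: algebra_simps flip: power_mult)
  qed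
  also have "\<dots> = S ^ n * ?X ^ (b * n) * (\<Prod>k<n. (?X ^ c) ^ k) * (\<Prod>k<n. 1 + S * ?X ^ (c * (n - Suc k) + a))"
    by (simp add: prod.distrib power_mult_distrib flip: power_mult)
  also have "(\<Prod>k<n. 1 + S * ?X ^ (c * (n - Suc k) + a)) = ?PA"
    unfolding S_def c_def by (rule prod.nat_diff_reindex)
  also have "(\<Prod>k<n. (?X ^ c) ^ k) = ?X ^ (c * (n choose 2))"
    by (induction n) (simp_all add: numeral_2_eq_2 power_add algebra_simps flip: power_mult)
  finally have L: "(\<Prod>k<2 * n. ?X ^ (c * n) + (S * ?X ^ b) * (?X ^ c) ^ k) = S ^ n * ?X ^ M * (?PB * ?PA)"
    by (simp add: M_def power_add mult_ac)
  have "(\<Prod>k<2 * n. ?X ^ (c * n) + (S * ?X ^ b) * (?X ^ c) ^ k) =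
    (\<Sum>i\<le>2 * n. gauss_binomial (?X ^ c) (2 * n) i * (?X ^ c) ^ (i choose 2) * (S * ?X ^ b) ^ i * (?X ^ (c * n)) ^ (2 * n - i))"
    by (rule q_binomial)
  also have "\<dots> = S ^ n * ?X ^ M * ?R"
    unfolding sum_distrib_left
  proof (intro sum.cong refl)
    fix i assume i: "i \<in> {..2 * n}"
    define e where "e = nat (theta_exp a b (int i - int n))"
    have e: "int e = theta_exp a b (int i - int n)"
      using theta_exp_ge[OF ab, of "int i - int n"] by (simp add: e_def)
    have d: "int (2 * n - i) = 2 * int n - int i" using i by simp
    \<comment> \<open>Exponents are compared after doubling, which clears the halves in
      \<open>choose 2\<close> and \<open>theta_exp\<close>.\<close>
    have "int (2 * (c * (i choose 2) + b * i + c * n * (2 * n - i)))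
        = int c * (2 * int (i choose 2)) + 2 * int b * int i + 2 * int c * int n * (2 * int n - int i)"
      unfolding of_nat_mult of_nat_add d by (simp add: algebra_simps)
    also have "\<dots> = int c * (2 * int (n choose 2)) + 2 * int c * int n * int n + 2 * int b * int n + 2 * theta_exp a b (int i - int n)"
      unfolding choose_two_int theta_exp_double c_def by (simp add: algebra_simps)
    also have "\<dots> = int (2 * (M + e))"
      by (simp add: M_def e algebra_simps)
    finally have E: "c * (i choose 2) + b * i + c * n * (2 * n - i) = M + e"
      unfolding of_nat_eq_iff by simp
    have "even (n + nat \<bar>int i - int n\<bar> + i)"
      by (simp add: even_nat_iff) presburger
    then have "s ^ i = s ^ (n + nat \<bar>int i - int n\<bar>)"
      by (intro sign_power_parity[OF s]) (simp add: add.commute)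
    then have S: "S ^ i = S ^ n * fps_const (s ^ nat \<bar>int i - int n\<bar>)"
      by (simp add: S_def fps_const_power power_add)
    have "(?X ^ c) ^ (i choose 2) * (S * ?X ^ b) ^ i * (?X ^ (c * n)) ^ (2 * n - i) = S ^ i * ?X ^ (M + e)"
      unfolding E[symmetric] by (simp add: power_mult_distrib power_add mult_ac flip: power_mult)
    also have "\<dots> = S ^ n * ?X ^ M * (fps_const (s ^ nat \<bar>int i - int n\<bar>) * ?X ^ e)"
      unfolding S by (simp add: power_add mult_ac)
    finally show "gauss_binomial (?X ^ c) (2 * n) i * (?X ^ c) ^ (i choose 2) * (S * ?X ^ b) ^ i * (?X ^ (c * n)) ^ (2 * n - i)
      = S ^ n * ?X ^ M * (gauss_binomial (?X ^ (a + b)) (2 * n) i * (fps_const (s ^ nat \<bar>int i - int n\<bar>)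
        * ?X ^ nat (theta_exp a b (int i - int n))))"
      unfolding e_def[symmetric] c_def[symmetric] by (simp add: mult_ac)
  qed
  finally have "S ^ n * ?X ^ M * (?PB * ?PA) = S ^ n * ?X ^ M * ?R" unfolding L .
  moreover have "S ^ n * ?X ^ M \<noteq> 0"
    using SS by auto
  ultimately show ?thesis by (rule mult_left_cancel[THEN iffD1, rotated])
qed

lemma qprod_progression_X_dvd:
  assumes "N \<le> n" "0 < c" "0 < r"
  shows "fps_X ^ Suc N dvd qprod s (range (\<lambda>k. c * k + r)) - (\<Prod>k<n. 1 + fps_const s * fps_X ^ (c * k + r))"
proof -
  have "inj_on (\<lambda>k. c * k + r) {..<n}" using assms by (auto simp: inj_on_def)
  then have "(\<Prod>k<n. 1 + fps_const s * fps_X ^ (c * k + r))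
    = (\<Prod>k\<in>(\<lambda>k. c * k + r) ` {..<n}. 1 + fps_const s * fps_X ^ k :: int fps)"
    by (simp add: prod.reindex)
  moreover have "k < n" if "c * k + r \<le> N" for k
  proof -
    have "1 * k \<le> c * k" using assms by (intro mult_right_mono) auto
    then show ?thesis using that assms by linarith
  qed
  then have "range (\<lambda>k. c * k + r) \<inter> {..N} \<subseteq> (\<lambda>k. c * k + r) ` {..<n}" by auto
  ultimately show ?thesis
    using qprod_X_dvd[of "(\<lambda>k. c * k + r) ` {..<n}" "range (\<lambda>k. c * k + r)" N s] by auto
qed

text \<open>The finite version is multiplied by the product \<open>D\<close> of all 1 - x^(ck), with
  c = a + b, and read modulo x^(N+1). Summands with exponent above \<open>N\<close> drop out; in the
  others the Gaussian binomial times \<open>D\<close> is congruent to 1.\<close>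

theorem jacobi_triple_product:
  fixes s :: int
  assumes s: "s * s = 1" and ab: "0 < a" "0 < b"
  shows "gser UNIV (\<lambda>j. s ^ nat \<bar>j\<bar>) (theta_exp a b)
    = qprod s (range (\<lambda>k. (a + b) * k + b)) * qprod s (range (\<lambda>k. (a + b) * k + a))
      * qprod (-1) (range (\<lambda>k. (a + b) * k + (a + b)))"
proof (rule fps_ext)
  fix N :: nat
  \<comment> \<open>A summand that survives has |i - n| at most \<open>N\<close>, so with this
    choice both \<open>i\<close> and \<open>2 * n - i\<close> are at least \<open>N\<close>.\<close>
  define n where "n = 2 * N"
  define c where "c = a + b"
  define D where "D = qprod (-1) (range (\<lambda>k. c * k + c))"
  define t :: "nat \<Rightarrow> int fps" where "t i = fps_const (s ^ nat \<bar>int i - int n\<bar>) * fps_X ^ nat (theta_exp a b (int i - int n))" for i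
  let ?X = "fps_X :: int fps"
  have c: "0 < c" using ab by (simp add: c_def)
  have "fps_X ^ Suc N dvd qprod s (range (\<lambda>k. c * k + b)) * qprod s (range (\<lambda>k. c * k + a)) * D
      - (\<Sum>i\<le>2 * n. gauss_binomial (?X ^ c) (2 * n) i * t i) * D"
    unfolding t_def c_def finite_jacobi_triple_product[OF s ab, symmetric]
    by (intro X_dvd_mult_cong qprod_progression_X_dvd) (use ab in \<open>auto simp: n_def\<close>)
  then have "fps_nth (qprod s (range (\<lambda>k. c * k + b)) * qprod s (range (\<lambda>k. c * k + a)) * D) N
      = fps_nth ((\<Sum>i\<le>2 * n. gauss_binomial (?X ^ c) (2 * n) i * t i) * D) N"
    by (rule X_dvd_imp_nth_eq) simp
  also have "\<dots> = (\<Sum>i\<le>2 * n. fps_nth (gauss_binomial (?X ^ c) (2 * n) i * D * t i) N)"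
    by (simp add: sum_distrib_left fps_sum_nth mult_ac)
  also have "\<dots> = (\<Sum>i\<le>2 * n. if theta_exp a b (int i - int n) = int N then s ^ nat \<bar>int i - int n\<bar> else 0)"
  proof (intro sum.cong refl)
    fix i assume "i \<in> {..2 * n}"
    define e where "e = theta_exp a b (int i - int n)"
    have e: "\<bar>int i - int n\<bar> \<le> e" unfolding e_def by (rule theta_exp_ge[OF ab])
    show "fps_nth (gauss_binomial (?X ^ c) (2 * n) i * D * t i) N
      = (if theta_exp a b (int i - int n) = int N then s ^ nat \<bar>int i - int n\<bar> else 0)"
    proof (cases "e \<le> int N")
      case False
      have "gauss_binomial (?X ^ c) (2 * n) i * D * t i
        = ?X ^ nat e * (gauss_binomial (?X ^ c) (2 * n) i * D * fps_const (s ^ nat \<bar>int i - int n\<bar>))"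
        unfolding t_def e_def by (simp only: mult_ac)
      moreover have "N < nat e" using False by linarith
      ultimately show ?thesis using False by (simp only: fps_X_power_mult_nth flip: e_def) simp
    next
      case True
      define j where "j = 2 * n - i"
      have ij: "2 * n = i + j" "N \<le> i" "N \<le> j" using True e by (auto simp: j_def n_def)
      have D: "fps_X ^ Suc N dvd D - qfact (?X ^ c) m" if "N \<le> m" for m
      proof -
        have "qfact (?X ^ c) m = (\<Prod>k<m. 1 + fps_const (-1) * ?X ^ (c * k + c))"
          unfolding qfact_def
          by (rule prod.reindex_bij_witness[of _ Suc "\<lambda>k. k - 1"])
             (auto simp: algebra_simps simp flip: power_mult fps_const_neg)
        then show ?thesis unfolding D_def using qprod_progression_X_dvd[OF that c c] by simp
      qed
      let ?g = "gauss_binomial (?X ^ c) (i + j) i"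
      \<comment> \<open>\<open>D\<close> is congruent to each q-factorial of index at least
        \<open>N\<close>, so \<open>gauss_binomial_qfact\<close> reads ?g D D = D modulo x^(N+1).
        One factor \<open>D\<close> is then cancelled.\<close>
      have "fps_X ^ Suc N dvd ?g * D * D - ?g * qfact (?X ^ c) i * qfact (?X ^ c) j"
        by (intro X_dvd_mult_cong D) (use ij in auto)
      moreover have "fps_X ^ Suc N dvd D - qfact (?X ^ c) (i + j)"
        by (rule D) (use ij in auto)
      ultimately have "fps_X ^ Suc N dvd ?g * D * D - D"
        unfolding gauss_binomial_qfact by (rule X_dvd_common)
      then have "fps_X ^ Suc N dvd D * (?g * D - 1)" by (simp add: algebra_simps)
      moreover have "fps_nth D 0 = 1"
        unfolding D_def by (rule qprod_nonzero(1)) (use c in auto)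
      ultimately have "fps_X ^ Suc N dvd ?g * D - 1"
        by (rule dvd_mult_fps_unitD)
      then have "fps_X ^ Suc N dvd ?g * D * t i - 1 * t i"
        by (intro X_dvd_mult_cong) auto
      then have "fps_nth (?g * D * t i) N = fps_nth (1 * t i) N"
        by (rule X_dvd_imp_nth_eq) simp
      moreover have "int N = e \<longleftrightarrow> N = nat e" using e by linarith
      ultimately show ?thesis unfolding ij(1) t_def e_def[symmetric] by (auto simp: fps_X_power_nth)
    qed
  qed
  also have "\<dots> = (\<Sum>i | i \<in> {..2 * n} \<and> theta_exp a b (int i - int n) = int N. s ^ nat \<bar>int i - int n\<bar>)"
    by (rule sum.inter_filter[symmetric]) simp
  \<comment> \<open>Every \<open>j\<close> with exponent \<open>N\<close> has |j| at most
    \<open>N\<close>, hence at most \<open>n\<close>, so the finite window misses none.\<close>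
  also have "\<dots> = (\<Sum>j | j \<in> UNIV \<and> theta_exp a b j = int N. s ^ nat \<bar>j\<bar>)"
  proof (rule sum.reindex_bij_witness[of _ "\<lambda>j. nat (j + int n)" "\<lambda>i. int i - int n"])
    fix j assume "j \<in> {j. j \<in> UNIV \<and> theta_exp a b j = int N}"
    then have "\<bar>j\<bar> \<le> int N" "theta_exp a b j = int N" using theta_exp_ge[OF ab, of j] by auto
    then show "int (nat (j + int n)) - int n = j" 
      "nat (j + int n) \<in> {i. i \<in> {..2 * n} \<and> theta_exp a b (int i - int n) = int N}"
      by (auto simp: n_def)
  qed auto
  finally show "fps_nth (gser UNIV (\<lambda>j. s ^ nat \<bar>j\<bar>) (theta_exp a b)) N
    = fps_nth (qprod s (range (\<lambda>k. (a + b) * k + b)) * qprod s (range (\<lambda>k. (a + b) * k + a))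
      * qprod (-1) (range (\<lambda>k. (a + b) * k + (a + b)))) N"
    unfolding gser_nth D_def c_def by simp
qed

section \<open>Generating functions of overpartitions\<close>

declare of_nat_sum [simp del] of_nat_sum_mset [simp del]

lemma finite_sets_sum_le: "finite {A. finite A \<and> A \<subseteq> S \<and> \<Sum>A \<le> (n::nat)}"
proof (rule finite_subset)
  show "{A. finite A \<and> A \<subseteq> S \<and> \<Sum>A \<le> n} \<subseteq> Pow {..n}"
    using member_le_sum[of _ _ "\<lambda>x::nat. x"] by (auto intro: order_trans)
qed simp

lemma graded_sets: "graded {A. finite A \<and> A \<subseteq> S} (\<lambda>A. int (\<Sum>A))"
  unfolding graded_def by (auto intro: finite_subset[OF _ finite_sets_sum_le[of S]])

text \<open>Expanding the product amounts to choosing a subset of the exponents, that is, a set of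
  distinct parts.\<close>

lemma qprod_sets: "qprod 1 S = gser {A. finite A \<and> A \<subseteq> S} (\<lambda>_. 1) (\<lambda>A. int (\<Sum>A))"
proof (rule fps_ext)
  fix n
  have "(\<Prod>k\<in>S \<inter> {..n}. 1 + fps_const 1 * fps_X ^ k) = (\<Prod>k\<in>S \<inter> {..n}. fps_X ^ k + 1 :: int fps)"
    by (simp add: add.commute)
  also have "\<dots> = (\<Sum>A\<in>Pow (S \<inter> {..n}). fps_X ^ \<Sum>A)"
    by (simp add: prod_add power_sum)
  finally have "fps_nth (qprod 1 S) n = (\<Sum>A\<in>Pow (S \<inter> {..n}). if \<Sum>A = n then 1 else 0)"
    by (simp add: qprod_def fps_sum_nth fps_X_power_nth eq_commute)
  also have "\<dots> = (\<Sum>A | A \<in> Pow (S \<inter> {..n}) \<and> \<Sum>A = n. 1)"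
    by (subst sum.inter_filter) auto
  also have "{A. A \<in> Pow (S \<inter> {..n}) \<and> \<Sum>A = n} = {A. A \<in> {A. finite A \<and> A \<subseteq> S} \<and> int (\<Sum>A) = int n}"
    using member_le_sum[of _ _ "\<lambda>x::nat. x"] by (auto intro: finite_subset)
  finally show "fps_nth (qprod 1 S) n = fps_nth (gser {A. finite A \<and> A \<subseteq> S} (\<lambda>_. 1) (\<lambda>A. int (\<Sum>A))) n"
    by (simp add: gser_nth)
qed

section \<open>Ordinary partitions with a lower bound on the parts\<close>

definition msets_above :: "nat \<Rightarrow> nat multiset set" where
  "msets_above K = {M. \<forall>x\<in>#M. K < x}"

lemma finite_msets_sum: "finite {M \<in> msets_above K. sum_mset M = n}"
proof (rule finite_subset)
  show "{M \<in> msets_above K. sum_mset M = n} \<subseteq> mset ` {xs. set xs \<subseteq> {..n} \<and> length xs \<le> n}"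
  proof
    fix M assume M: "M \<in> {M \<in> msets_above K. sum_mset M = n}"
    obtain xs where xs: "M = mset xs" by (metis ex_mset)
    have "length xs \<le> sum_list xs" "set xs \<subseteq> {..sum_list xs}"
      using M sum_list_mono[of xs "\<lambda>_. 1" "\<lambda>x. x"] member_le_sum_list
      by (fastforce simp: xs msets_above_def sum_list_triv)+
    then show "M \<in> mset ` {xs. set xs \<subseteq> {..n} \<and> length xs \<le> n}"
      using M by (auto simp: xs sum_mset_sum_list)
  qed
qed (use finite_lists_length_le in auto)

lemma graded_msets: "graded (msets_above K) (\<lambda>M. int (sum_mset M))"
  using finite_msets_sum[of K] by (auto simp: graded_def)

abbreviation partition_gf :: "nat \<Rightarrow> int fps" where
  "partition_gf K \<equiv> gser (msets_above K) (\<lambda>_. 1) (\<lambda>M. int (sum_mset M))"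

text \<open>A partition into parts above \<open>K\<close> either avoids \<open>Suc K\<close> or
  arises uniquely by adding one copy of \<open>Suc K\<close> to such a partition. This strips one
  Euler factor at a time.\<close>

lemma partition_gf_step: "partition_gf K * (1 - fps_X ^ Suc K) = partition_gf (Suc K)"
proof -
  let ?J = "{M \<in> msets_above K. Suc K \<in># M}"
  have split: "msets_above K = msets_above (Suc K) \<union> ?J"
    by (auto simp: msets_above_def Suc_lessI) (metis Suc_lessI)
  have "partition_gf K = partition_gf (Suc K) + gser ?J (\<lambda>_. 1) (\<lambda>M. int (sum_mset M))"
    using gser_Un[of "msets_above (Suc K)" ?J] graded_msets[of K]
    unfolding split[symmetric] by (auto simp: msets_above_def)
  also have "gser ?J (\<lambda>_. 1) (\<lambda>M. int (sum_mset M)) = gser (msets_above K) (\<lambda>_. 1) (\<lambda>M. int (Suc K) + int (sum_mset M))"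
    by (rule gser_reindex[of "add_mset (Suc K)"])
       (auto simp: msets_above_def intro!: bij_betw_byWitness[of _ "\<lambda>M. M - {#Suc K#}"] dest: in_diffD)
  also have "\<dots> = fps_X ^ Suc K * partition_gf K"
    by (rule fps_X_power_gser[OF graded_msets, symmetric])
  finally show ?thesis by (simp add: algebra_simps)
qed

lemma partition_gf_prod: "partition_gf 0 * (\<Prod>k\<in>{1..K}. 1 + fps_const (-1) * fps_X ^ k) = partition_gf K"
proof (induction K)
  case (Suc K)
  have "partition_gf 0 * (\<Prod>k\<in>{1..Suc K}. 1 + fps_const (-1) * fps_X ^ k)
      = (partition_gf 0 * (\<Prod>k\<in>{1..K}. 1 + fps_const (-1) * fps_X ^ k)) * (1 - fps_X ^ Suc K)"
    by (simp add: prod.nat_ivl_Suc' mult_ac flip: fps_const_neg)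
  then show ?case unfolding Suc.IH partition_gf_step .
qed simp

text \<open>Once the factors up to \<open>n\<close> are stripped, all parts exceed \<open>n\<close>,
  so the empty partition alone contributes to coefficients up to \<open>n\<close>.\<close>

lemma partition_gf_inverse: "partition_gf 0 * qprod (-1) {0<..} = 1"
proof (rule fps_eqI_X_dvd)
  fix n
  have "fps_X ^ Suc n dvd partition_gf 0 * qprod (-1) {0<..}
      - partition_gf 0 * (\<Prod>k\<in>{1..n}. 1 + fps_const (-1) * fps_X ^ k)"
    by (intro X_dvd_mult_cong qprod_X_dvd) auto
  moreover have "fps_X ^ Suc n dvd 1 - partition_gf n"
  proof (rule nth_eq_imp_X_dvd)
    fix m assume "m \<le> n"
    have "{M. M \<in> msets_above n \<and> int (sum_mset M) = int m} = (if m = 0 then {{#}} else {})"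
    proof -
      have empty: "M = {#}" if M: "M \<in> msets_above n" "sum_mset M = m" for M
      proof (rule ccontr)
        assume "M \<noteq> {#}"
        then obtain x N where "M = add_mset x N" by (metis multi_nonempty_split)
        then show False using M \<open>m \<le> n\<close> by (auto simp: msets_above_def)
      qed
      have "{M. M \<in> msets_above n \<and> sum_mset M = m} \<subseteq> {{#}}"
        using empty by blast
      moreover have "{#} \<in> {M. M \<in> msets_above n \<and> sum_mset M = m} \<longleftrightarrow> m = 0"
        by (auto simp: msets_above_def)
      ultimately show ?thesis by auto
    qed
    then show "fps_nth 1 m = fps_nth (partition_gf n) m" by (simp add: gser_nth)
  qed
  ultimately show "fps_X ^ Suc n dvd partition_gf 0 * qprod (-1) {0<..} - 1"
    by (metis X_dvd_common partition_gf_prod)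
qed

section \<open>The two overpartition series\<close>

lemma pbar_gf: "Abs_fps (\<lambda>n. int (pbar n)) * qprod (-1) {0<..} = qprod 1 {0<..}"
proof -
  let ?I = "{(M, A :: nat set). M \<in> msets_above 0 \<and> A \<subseteq> set_mset M}"
  have "Abs_fps (\<lambda>n. int (pbar n)) = gser ?I (\<lambda>_. 1) (\<lambda>(M, A). int (sum_mset M))"
  proof (rule fps_ext)
    fix n
    have "overpartitions n = {p. p \<in> ?I \<and> (case p of (M, A) \<Rightarrow> int (sum_mset M)) = int n}"
      by (auto simp: overpartitions_def msets_above_def)
    then show "fps_nth (Abs_fps (\<lambda>n. int (pbar n))) n = fps_nth (gser ?I (\<lambda>_. 1) (\<lambda>(M, A). int (sum_mset M))) n"
      by (simp add: gser_nth pbar_def)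
  qed
  also have "\<dots> = gser (msets_above 0 \<times> {A. finite A \<and> A \<subseteq> {0<..}}) (\<lambda>(i,j). 1 * 1)
      (\<lambda>(M, A). int (sum_mset M) + int (\<Sum>A))"
  \<comment> \<open>One copy of each overlined size is moved out of the multiset, which separates an
    overpartition into a free partition and a free set of distinct parts.\<close>
  proof (rule gser_reindex[of "\<lambda>(M, A). (M + mset_set A, A)"])
    show "bij_betw (\<lambda>(M, A). (M + mset_set A, A)) (msets_above 0 \<times> {A. finite A \<and> A \<subseteq> {0<..}}) ?I"
    proof (rule bij_betw_byWitness[of _ "\<lambda>(M, A). (M - mset_set A, A)"])
      show "(\<lambda>(M, A). (M - mset_set A, A)) ` ?I \<subseteq> msets_above 0 \<times> {A. finite A \<and> A \<subseteq> {0<..}}"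
        by (auto simp: msets_above_def dest: in_diffD intro: finite_subset[OF _ finite_set_mset])
      \<comment> \<open>Containment ensures that the multiset difference is not truncated, so adding
        \<open>mset_set A\<close> back restores \<open>M\<close>.\<close>
      have "mset_set A \<subseteq># M" if "A \<subseteq> set_mset M" for A and M :: "nat multiset"
        using that finite_subset[OF that]
        by (simp add: subseteq_mset_def count_mset_set') (auto simp: Suc_le_eq)
      then show "\<forall>a'\<in>?I. (\<lambda>(M, A). (M + mset_set A, A)) ((\<lambda>(M, A). (M - mset_set A, A)) a') = a'"
        by auto
    qed (auto simp: msets_above_def)
  qed (auto simp: sum_unfold_sum_mset)
  also have "\<dots> = partition_gf 0 * qprod 1 {0<..}"
    by (simp only: qprod_sets gser_mult[OF graded_msets graded_sets])
  finally show ?thesis using partition_gf_inverse by (simp add: mult_ac)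
qed

text \<open>The two-colour encoding is already a direct product of three choices. The first
  overlined colour splits into even parts and parts in \<open>T\<close>; the second colour supplies
  the other factor of the square.\<close>

lemma pbar_r_gf:
  fixes T :: "nat set"
  defines "T \<equiv> {x. x mod 8 = 1 \<or> x mod 8 = 7}"
  shows "Abs_fps (\<lambda>n. int (pbar_r n)) * qprod (-1) {0<..} = qprod 1 ((*) 2 ` {0<..}) * qprod 1 T ^ 2"
proof -
  let ?S = "(*) 2 ` {0<..} \<union> T"
  let ?F = "\<lambda>S. {A :: nat set. finite A \<and> A \<subseteq> S}"
  have S: "x \<in> ?S \<longleftrightarrow> 0 < x \<and> (even x \<or> x mod 8 = 1 \<or> x mod 8 = 7)" for x
    by (auto simp: T_def image_iff elim!: evenE intro: Nat.gr0I)
  have "Abs_fps (\<lambda>n. int (pbar_r n)) = gser (msets_above 0 \<times> (?F ?S \<times> ?F T)) (\<lambda>(i,j). 1 * (case j of (k,l) \<Rightarrow> 1 * 1))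
      (\<lambda>(M, D). int (sum_mset M) + (case D of (A, B) \<Rightarrow> int (\<Sum>A) + int (\<Sum>B)))"
  proof (rule fps_ext)
    fix n
    have "overpartitions_r n = {p. p \<in> msets_above 0 \<times> (?F ?S \<times> ?F T)
      \<and> (case p of (M, D) \<Rightarrow> int (sum_mset M) + (case D of (A, B) \<Rightarrow> int (\<Sum>A) + int (\<Sum>B))) = int n}"
      unfolding overpartitions_r_def subset_iff S
      by (auto simp: msets_above_def T_def simp flip: of_nat_add)
    then show "fps_nth (Abs_fps (\<lambda>n. int (pbar_r n))) n = fps_nth (gser (msets_above 0 \<times> (?F ?S \<times> ?F T)) (\<lambda>(i,j). 1 * (case j of (k,l) \<Rightarrow> 1 * 1))
      (\<lambda>(M, D). int (sum_mset M) + (case D of (A, B) \<Rightarrow> int (\<Sum>A) + int (\<Sum>B)))) n"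
      by (simp add: gser_nth pbar_r_def case_prod_beta)
  qed
  also have "\<dots> = partition_gf 0 * (qprod 1 ?S * qprod 1 T)"
    unfolding qprod_sets
    by (simp only: gser_mult[OF graded_sets graded_sets] gser_mult[OF graded_msets graded_Times[OF graded_sets graded_sets]])
  also have "qprod 1 ?S = qprod 1 ((*) 2 ` {0<..}) * qprod 1 T"
  proof (rule qprod_mult_disjoint[symmetric])
    have "odd x" if "x \<in> T" for x :: nat
      using that unfolding T_def by auto presburger+
    then show "(*) 2 ` {0<..} \<inter> T = {}" by fastforce
  qed
  finally show ?thesis using partition_gf_inverse by (simp add: mult_ac power2_eq_square)
qed

section \<open>Theta function identities\<close>

definition progression :: "nat \<Rightarrow> nat \<Rightarrow> nat set" where
  "progression d r = range (\<lambda>k. d * k + r)"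

lemma progression_split:
  assumes "0 < d"
  shows "progression d r = progression (2 * d) r \<union> progression (2 * d) (r + d)"
    and "progression (2 * d) r \<inter> progression (2 * d) (r + d) = {}"
proof -
  show "progression d r = progression (2 * d) r \<union> progression (2 * d) (r + d)"
  proof (intro equalityI subsetI)
    fix x assume "x \<in> progression d r"
    then obtain k where k: "x = d * k + r" by (auto simp: progression_def)
    show "x \<in> progression (2 * d) r \<union> progression (2 * d) (r + d)"
      by (cases "even k") (auto simp: k progression_def image_iff algebra_simps elim!: evenE oddE)
  next
    fix x assume "x \<in> progression (2 * d) r \<union> progression (2 * d) (r + d)"
    then obtain k where "x = d * (2 * k) + r \<or> x = d * (2 * k + 1) + r"
      by (auto simp: progression_def algebra_simps)
    then show "x \<in> progression d r" unfolding progression_def by blast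
  qed
  have "2 * d * k + r \<noteq> 2 * d * l + (r + d)" for k l
  proof
    assume "2 * d * k + r = 2 * d * l + (r + d)"
    then have "d * (2 * k) = d * (2 * l + 1)" by (simp add: algebra_simps)
    then have "2 * k = 2 * l + 1" using assms by (metis mult_left_cancel neq0_conv)
    then show False by presburger
  qed
  then show "progression (2 * d) r \<inter> progression (2 * d) (r + d) = {}"
    unfolding progression_def by auto
qed

lemma qprod_progression_split:
  "0 < d \<Longrightarrow> qprod s (progression d r) = qprod s (progression (2 * d) r) * qprod s (progression (2 * d) (r + d))"
  using progression_split[of d r] qprod_mult_disjoint by metis

lemma double_progression: "(*) 2 ` progression d r = progression (2 * d) (2 * r)"
  unfolding progression_def by (auto simp: image_iff algebra_simps)

lemma qprod_progression_plus_minus: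
  "qprod 1 (progression d r) * qprod (-1) (progression d r) = qprod (-1) (progression (2 * d) (2 * r))"
  by (simp only: qprod_plus_minus double_progression)

lemma positive_progression: "{0<..} = progression 1 1"
  unfolding progression_def by (auto simp: image_iff Suc_le_eq) (metis Suc_pred)

lemma mod_8_progression: "{x. x mod 8 = 1 \<or> x mod 8 = 7} = progression 8 1 \<union> progression 8 7"
proof -
  have "x mod 8 = r \<longleftrightarrow> (\<exists>k. x = 8 * k + r)" if "r < 8" for x r :: nat
    using that by (metis mod_less mod_mult_self2 mult_div_mod_eq add.commute)
  from this[of 1] this[of 7] show ?thesis by (auto simp: progression_def image_iff)
qed

text \<open>For \<open>s\<close> equal to 1 or -1 this is Ramanujan's f(s x^a, s x^b).\<close>

abbreviation theta :: "int \<Rightarrow> nat \<Rightarrow> nat \<Rightarrow> int fps" where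
  "theta s a b \<equiv> gser UNIV (\<lambda>j. s ^ nat \<bar>j\<bar>) (theta_exp a b)"

lemma theta_product:
  assumes "s * s = 1" "0 < a" "0 < b"
  shows "theta s a b = qprod s (progression (a + b) b) * qprod s (progression (a + b) a) * qprod (-1) (progression (a + b) (a + b))"
  unfolding progression_def by (rule jacobi_triple_product[OF assms])

lemma theta_exp_eqI: "(\<And>j. 2 * f j = int (a + b) * (j * (j - 1)) + 2 * int b * j) \<Longrightarrow> theta_exp a b = f"
  unfolding fun_eq_iff by (metis theta_exp_double mult_cancel_left zero_neq_numeral)

text \<open>Dictionary: \<open>theta s 1 1\<close> is \<phi>(s x), \<open>theta (-1) 2 2\<close> is
  \<phi>(-x^2), \<open>theta 1 4 4\<close> is \<phi>(x^4), \<open>theta s 6 2\<close> is \<psi>(s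
  x^2) and \<open>theta 1 24 8\<close> is \<psi>(x^8).\<close>

lemma theta_exp_1_1: "theta_exp 1 1 = (\<lambda>j. j * j)"
  and theta_exp_2_2: "theta_exp 2 2 = (\<lambda>j. 2 * (j * j))"
  and theta_exp_4_4: "theta_exp 4 4 = (\<lambda>j. 4 * (j * j))"
  and theta_exp_6_2: "theta_exp 6 2 = (\<lambda>j. 4 * (j * j) - 2 * j)"
  and theta_exp_14_2: "theta_exp 14 2 = (\<lambda>j. 8 * (j * j) - 6 * j)"
  and theta_exp_24_8: "theta_exp 24 8 = (\<lambda>j. 16 * (j * j) - 8 * j)"
  by (intro theta_exp_eqI; simp add: algebra_simps)+

lemma minus_one_power_nat_abs: "(-1) ^ nat \<bar>j\<bar> = (if even j then 1 else -1 :: int)"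
  by (simp add: minus_one_power_iff even_nat_iff)

lemmas theta_simps = theta_exp_1_1 theta_exp_1_1[unfolded One_nat_def] theta_exp_2_2 theta_exp_4_4 theta_exp_6_2 theta_exp_14_2
  theta_exp_24_8 minus_one_power_nat_abs power_one

section \<open>Identities from parity and changes of summation variables\<close>

lemma phi_even_part: "theta 1 1 1 + theta (-1) 1 1 = 2 * theta 1 4 4"
proof -
  have "theta 1 1 1 + theta (-1) 1 1 = gser UNIV (\<lambda>j. 1 + (-1) ^ nat \<bar>j\<bar>) (theta_exp 1 1)"
    by (simp add: gser_add)
  also have "\<dots> = gser {j. even j} (\<lambda>j. 1 + (-1) ^ nat \<bar>j\<bar>) (theta_exp 1 1)"
    by (rule gser_restrict) (auto simp: graded_theta minus_one_power_nat_abs)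
  also have "\<dots> = gser UNIV (\<lambda>j. 2 * 1 ^ nat \<bar>j\<bar>) (theta_exp 4 4)"
    by (rule gser_reindex[of "\<lambda>j. 2 * j"])
       (auto simp: theta_simps intro!: bij_betw_byWitness[of _ "\<lambda>j. j div 2"])
  finally show ?thesis by (simp only: gser_numeral_mult)
qed

text \<open>Only odd indices survive. The classes 3 and 1 modulo 4, parametrised by 4j - 1 and 1 -
  4j, contribute equally because (4j - 1)^2 = 1 + (16j^2 - 8j).\<close>

lemma phi_odd_part: "theta 1 1 1 - theta (-1) 1 1 = 4 * fps_X * theta 1 24 8"
proof -
  let ?J = "{j::int. j mod 4 = 3}" and ?K = "{j::int. j mod 4 = 1}"
  have *: "gser J (\<lambda>j. 1 - (-1) ^ nat \<bar>j\<bar>) (theta_exp 1 1) = 2 * (fps_X * theta 1 24 8)"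
    if "bij_betw h UNIV J" "\<And>j. h j = 4 * j - 1 \<or> h j = 1 - 4 * j" for h J
  proof -
    have "gser J (\<lambda>j. 1 - (-1) ^ nat \<bar>j\<bar>) (theta_exp 1 1) = gser UNIV (\<lambda>j. 2 * 1 ^ nat \<bar>j\<bar>) (\<lambda>j. int 1 + theta_exp 24 8 j)"
    proof (rule gser_reindex[OF that(1)])
      fix j
      show "theta_exp 1 1 (h j) = int 1 + theta_exp 24 8 j"
        using that(2)[of j] by (elim disjE) (simp_all only: theta_simps, simp_all add: algebra_simps)
      show "1 - (-1) ^ nat \<bar>h j\<bar> = 2 * (1 ^ nat \<bar>j\<bar> :: int)"
        using that(2)[of j] by (auto simp: minus_one_power_nat_abs)
    qed
    also have "\<dots> = fps_X ^ 1 * gser UNIV (\<lambda>j. 2 * 1 ^ nat \<bar>j\<bar>) (theta_exp 24 8)"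
      by (rule fps_X_power_gser[symmetric]) (simp add: graded_theta)
    finally show ?thesis unfolding gser_numeral_mult[symmetric] power_one_right by (simp only: mult_ac)
  qed
  have "theta 1 1 1 - theta (-1) 1 1 = gser UNIV (\<lambda>j. 1 - (-1) ^ nat \<bar>j\<bar>) (theta_exp 1 1)"
    by (simp add: gser_diff)
  also have "\<dots> = gser (?J \<union> ?K) (\<lambda>j. 1 - (-1) ^ nat \<bar>j\<bar>) (theta_exp 1 1)"
    by (rule gser_restrict) (auto simp: graded_theta minus_one_power_nat_abs split: if_splits, presburger+)
  also have "\<dots> = gser ?J (\<lambda>j. 1 - (-1) ^ nat \<bar>j\<bar>) (theta_exp 1 1) + gser ?K (\<lambda>j. 1 - (-1) ^ nat \<bar>j\<bar>) (theta_exp 1 1)"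
    by (rule gser_Un) (auto intro: graded_subset[OF graded_theta])
  also have "gser ?J (\<lambda>j. 1 - (-1) ^ nat \<bar>j\<bar>) (theta_exp 1 1) = 2 * (fps_X * theta 1 24 8)"
  proof (rule *[of "\<lambda>j. 4 * j - 1"])
    show "bij_betw (\<lambda>j::int. 4 * j - 1) UNIV ?J"
      by (rule bij_betw_byWitness[of _ "\<lambda>j. (j + 1) div 4"]) (auto; presburger)+
  qed simp
  also have "gser ?K (\<lambda>j. 1 - (-1) ^ nat \<bar>j\<bar>) (theta_exp 1 1) = 2 * (fps_X * theta 1 24 8)"
  proof (rule *[of "\<lambda>j. 1 - 4 * j"])
    show "bij_betw (\<lambda>j::int. 1 - 4 * j) UNIV ?K"
      by (rule bij_betw_byWitness[of _ "\<lambda>j. (1 - j) div 4"]) (auto; presburger)+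
  qed simp
  finally show ?thesis by (simp add: algebra_simps)
qed

text \<open>Doubling symmetrises the weight to (-1)^i + (-1)^j, which vanishes when i + j is odd. On
  the other pairs, (i + j)^2 + (i - j)^2 = 2i^2 + 2j^2 separates the variables.\<close>

lemma phi_mult_phi_minus: "theta 1 1 1 * theta (-1) 1 1 = theta (-1) 2 2 ^ 2"
proof -
  let ?w = "\<lambda>j::int. (-1) ^ nat \<bar>j\<bar> :: int" and ?e = "\<lambda>(i,j). theta_exp 1 1 i + theta_exp 1 1 j"
  have g: "graded UNIV (theta_exp 1 1)" "graded UNIV (theta_exp 2 2)" by (simp_all add: graded_theta)
  have "2 * (theta 1 1 1 * theta (-1) 1 1) = theta (-1) 1 1 * theta 1 1 1 + theta 1 1 1 * theta (-1) 1 1"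
    by (simp add: mult.commute)
  also have "\<dots> = gser (UNIV \<times> UNIV) (\<lambda>(i,j). ?w i + ?w j) ?e"
    unfolding gser_mult[OF g(1) g(1)] gser_add by (rule gser_cong) auto
  also have "\<dots> = gser {(i,j). even (i + j)} (\<lambda>(i,j). ?w i + ?w j) ?e"
    by (rule gser_restrict[OF graded_Times[OF g(1) g(1)]]) (auto simp: minus_one_power_nat_abs split: if_splits)
  also have "\<dots> = gser (UNIV \<times> UNIV) (\<lambda>(i,j). 2 * (?w i * ?w j)) (\<lambda>(i,j). theta_exp 2 2 i + theta_exp 2 2 j)"
  proof (rule gser_reindex[of "\<lambda>(i,j). (i + j, i - j)"])
    show "bij_betw (\<lambda>(i,j). (i + j, i - j :: int)) (UNIV \<times> UNIV) {(i,j). even (i + j)}"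
      by (rule bij_betw_byWitness[of _ "\<lambda>(i,j). ((i + j) div 2, (i - j) div 2)"]) (auto, presburger+)
  qed (auto simp: theta_simps algebra_simps)
  also have "\<dots> = 2 * theta (-1) 2 2 ^ 2"
    unfolding power2_eq_square gser_mult[OF g(2) g(2)] gser_numeral_mult by (rule gser_cong) auto
  finally show ?thesis by simp
qed

lemma psi_phi_difference:
  "theta 1 6 2 * theta 1 4 4 - theta (-1) 6 2 * theta (-1) 4 4 = 2 * fps_X ^ 2 * theta 1 14 2 ^ 2"
proof -
  let ?w = "\<lambda>(i::int,j::int). 1 - (-1) ^ nat \<bar>i\<bar> * (-1) ^ nat \<bar>j\<bar> :: int"
  let ?e = "\<lambda>(i,j). theta_exp 6 2 i + theta_exp 4 4 j"
  have g: "graded UNIV (theta_exp 6 2)" "graded UNIV (theta_exp 4 4)" "graded UNIV (theta_exp 14 2)"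
    by (simp_all add: graded_theta)
  have "theta 1 6 2 * theta 1 4 4 - theta (-1) 6 2 * theta (-1) 4 4 = gser (UNIV \<times> UNIV) ?w ?e"
    unfolding gser_mult[OF g(1) g(2)] gser_diff by (rule gser_cong) auto
  also have "\<dots> = gser {(i,j). odd (i + j)} ?w ?e"
    by (rule gser_restrict[OF graded_Times[OF g(1) g(2)]]) (auto simp: minus_one_power_nat_abs split: if_splits)
  also have "\<dots> = gser (UNIV \<times> UNIV) (\<lambda>(i,j). 2 * (1 * 1))
      (\<lambda>p. int 2 + (case p of (i,j) \<Rightarrow> theta_exp 14 2 i + theta_exp 14 2 j))"
  \<comment> \<open>The pairs with odd sum are exactly of this form, and the substitution turns the
    exponent into 2 + (8i^2 - 6i) + (8j^2 - 6j), with no mixed term.\<close>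
  proof (rule gser_reindex[of "\<lambda>(i,j). (1 - i - j, i - j)"])
    show "bij_betw (\<lambda>(i,j). (1 - i - j, i - j :: int)) (UNIV \<times> UNIV) {(i,j). odd (i + j)}"
      by (rule bij_betw_byWitness[of _ "\<lambda>(i,j). ((1 - i + j) div 2, (1 - i - j) div 2)"])
         (auto, presburger+)
  qed (auto simp: theta_simps algebra_simps)
  also have "\<dots> = fps_X ^ 2 * gser (UNIV \<times> UNIV) (\<lambda>(i,j). 2 * (1 * 1)) (\<lambda>(i,j). theta_exp 14 2 i + theta_exp 14 2 j)"
    by (rule fps_X_power_gser[symmetric, OF graded_Times[OF g(3) g(3)]])
  also have "gser (UNIV \<times> UNIV) (\<lambda>(i,j). 2 * (1 * 1)) (\<lambda>(i,j). theta_exp 14 2 i + theta_exp 14 2 j) = 2 * theta 1 14 2 ^ 2"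
    unfolding power2_eq_square gser_mult[OF g(3) g(3)] gser_numeral_mult by (rule gser_cong) auto
  finally show ?thesis by (simp add: mult_ac)
qed

section \<open>Identities from the triple product\<close>

abbreviation P :: "nat \<Rightarrow> nat \<Rightarrow> int fps" where "P d r \<equiv> qprod 1 (progression d r)"
text \<open>In Pochhammer notation \<open>M d r\<close> is (x^r; x^d) and \<open>P d r\<close> is
  (-x^r; x^d), both infinite.\<close>

abbreviation M :: "nat \<Rightarrow> nat \<Rightarrow> int fps" where "M d r \<equiv> qprod (-1) (progression d r)"

lemma gauss_phi: "theta (-1) 2 2 * P 2 2 = M 2 2"
proof -
  have "theta (-1) 2 2 = M 4 2 * M 4 2 * M 4 4" using theta_product[of "-1" 2 2] by simp
  moreover have "P 2 2 * M 2 2 = M 4 4" using qprod_progression_plus_minus[of 2 2] by simp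
  moreover have "M 2 2 = M 4 2 * M 4 4" using qprod_progression_split[of 2 "-1" 2] by simp
  ultimately show ?thesis by algebra
qed

text \<open>Splitting the progressions modulo 4 into classes modulo 8 and using
  \<open>P 4 2 * M 4 2 = M 8 4\<close> brings both sides to
  \<open>M 4 2 * (M 8 4 * M 8 8) ^ 2\<close>.\<close>

lemma psi_phi_sign_change: "theta 1 6 2 * theta (-1) 2 2 = theta (-1) 6 2 * theta (-1) 4 4"
proof -
  have "theta 1 6 2 = P 8 2 * P 8 6 * M 8 8" "theta (-1) 6 2 = M 8 2 * M 8 6 * M 8 8"
    "theta (-1) 2 2 = M 4 2 * M 4 2 * M 4 4" "theta (-1) 4 4 = M 8 4 * M 8 4 * M 8 8"
    using theta_product[of 1 6 2] theta_product[of "-1" 6 2] theta_product[of "-1" 2 2] theta_product[of "-1" 4 4]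
    by simp_all
  moreover have "P 4 2 = P 8 2 * P 8 6" "M 4 2 = M 8 2 * M 8 6" "M 4 4 = M 8 4 * M 8 8"
    using qprod_progression_split[of 4 1 2] qprod_progression_split[of 4 "-1" 2] qprod_progression_split[of 4 "-1" 4]
    by simp_all
  moreover have "P 4 2 * M 4 2 = M 8 4" using qprod_progression_plus_minus[of 4 2] by simp
  ultimately show ?thesis by algebra
qed

text \<open>Brings in the product of \<open>pbar_r_gf\<close> at x^2. The remaining factors match
  because \<open>M 8 8 * P 16 8 * M 32 32 = M 16 16 ^ 2\<close>.\<close>

lemma theta_14_2_square:
  "P 2 2 * theta 1 14 2 ^ 2 = theta 1 6 2 * theta 1 24 8 * P 4 4 * (P 16 2 * P 16 14) ^ 2"
proof -
  have "theta 1 6 2 = P 8 2 * P 8 6 * M 8 8" "theta 1 14 2 = P 16 2 * P 16 14 * M 16 16"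
    "theta 1 24 8 = P 32 8 * P 32 24 * M 32 32"
    using theta_product[of 1 6 2] theta_product[of 1 14 2] theta_product[of 1 24 8] by simp_all
  moreover have "P 4 2 = P 8 2 * P 8 6" "P 2 2 = P 4 2 * P 4 4" "P 16 8 = P 32 8 * P 32 24"
    "M 8 8 = M 16 8 * M 16 16" "M 16 16 = M 32 16 * M 32 32"
    using qprod_progression_split[of 4 1 2] qprod_progression_split[of 2 1 2] qprod_progression_split[of 16 1 8]
      qprod_progression_split[of 8 "-1" 8] qprod_progression_split[of 16 "-1" 16] by simp_all
  moreover have "P 16 8 * M 16 8 = M 32 16" using qprod_progression_plus_minus[of 16 8] by simp
  ultimately show ?thesis by algebra
qed

lemma theta_nonzero:
  assumes "s * s = 1" "0 < a" "0 < b"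
  shows "theta s a b \<noteq> 0"
  unfolding theta_product[OF assms] using assms by (auto simp: progression_def qprod_nonzero(2) image_iff)

lemma even_odd_gf_mult_theta:
  fixes Ev Od :: "int fps"
  defines "Ev \<equiv> fps_compose (Abs_fps (\<lambda>n. int (pbar n))) (fps_X ^ 2)"
    and "Od \<equiv> fps_compose (Abs_fps (\<lambda>n. int (pbar_r n))) (fps_X ^ 2)"
  shows "(Ev + fps_X * Od) * (theta (-1) 1 1 + theta (-1) 2 2) = 2"
proof -
  define A where "A = theta (-1) 1 1"
  define B where "B = theta (-1) 2 2"
  define C where "C = theta 1 4 4"
  define D where "D = theta 1 24 8"
  have P22: "P 2 2 \<noteq> 0" by (rule qprod_nonzero(2)) (auto simp: progression_def)
  have X2: "fps_nth (fps_X ^ 2 :: int fps) 0 = 0" by simp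
  have "Ev * M 2 2 = P 2 2"
    unfolding Ev_def using arg_cong[OF pbar_gf, of "\<lambda>f. fps_compose f (fps_X ^ 2)"]
    by (simp add: fps_compose_mult_distrib[OF X2] qprod_compose_X2 positive_progression double_progression)
  moreover have "P 2 2 * (Ev * B) = Ev * (theta (-1) 2 2 * P 2 2)"
    by (simp add: B_def mult_ac)
  ultimately have "P 2 2 * (Ev * B) = P 2 2 * 1"
    by (simp add: gauss_phi)
  then have E: "Ev * B = 1" using P22 mult_left_cancel by blast
  \<comment> \<open>Disjointness of the residue classes, also after doubling, lets the product over
    their union split.\<close>
  have "progression 8 1 \<inter> progression 8 7 = {}" unfolding progression_def by (auto, presburger)
  then have "progression 16 2 \<inter> progression 16 14 = {}" unfolding progression_def by (auto, presburger)
  then have "Od * M 2 2 = P 4 4 * (P 16 2 * P 16 14) ^ 2"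
    unfolding Od_def using arg_cong[OF pbar_r_gf, of "\<lambda>f. fps_compose f (fps_X ^ 2)"]
    by (simp add: fps_compose_mult_distrib[OF X2] fps_compose_power[OF X2, symmetric] qprod_compose_X2 mod_8_progression[unfolded One_nat_def]
        positive_progression double_progression image_Un qprod_mult_disjoint)
  moreover have "P 2 2 * (Od * B) = Od * (theta (-1) 2 2 * P 2 2)"
    by (simp add: B_def mult_ac)
  ultimately have Od: "P 2 2 * (Od * B) = P 4 4 * (P 16 2 * P 16 14) ^ 2"
    by (simp add: gauss_phi)
  have "theta 1 6 2 * (C - B) = 2 * fps_X ^ 2 * theta 1 14 2 ^ 2"
    using psi_phi_difference psi_phi_sign_change unfolding B_def C_def by (simp add: algebra_simps)
  \<comment> \<open>The factor \<open>theta 1 6 2\<close> gives access to the \<psi>\<phi>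
    identities and \<open>P 2 2\<close> to the formula for \<open>Od\<close>; both are cancelled
    afterwards.\<close>
  then have "(theta 1 6 2 * P 2 2) * (C - B) = (theta 1 6 2 * P 2 2) * (2 * fps_X ^ 2 * D * (Od * B))"
    using theta_14_2_square Od unfolding D_def by algebra
  moreover have "theta 1 6 2 * P 2 2 \<noteq> 0" using P22 theta_nonzero[of 1 6 2] by simp
  ultimately have CB: "C - B = 2 * fps_X ^ 2 * D * (Od * B)" using mult_left_cancel by blast
  have "2 * (C - A) = 2 * (2 * fps_X * D)"
    using phi_even_part phi_odd_part unfolding A_def C_def D_def by algebra
  then have CA: "C - A = 2 * fps_X * D" by (metis mult_left_cancel zero_neq_numeral)
  have "theta 1 1 1 = 2 * C - A" using phi_even_part unfolding A_def C_def by algebra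
  then have AB: "(2 * C - A) * A = B ^ 2" using phi_mult_phi_minus unfolding A_def B_def by simp
  \<comment> \<open>Multiplying by \<open>B * (C - A)\<close> clears denominators: the left side
    becomes ((C - A) + (C - B))(A + B), which \<open>AB\<close> reduces to 2B(C - A).\<close>
  have "(B * (C - A)) * ((Ev + fps_X * Od) * (A + B)) = (B * (C - A)) * 2"
  proof -
    have "(C - A) * (fps_X * (Od * B)) = C - B" using CB CA by algebra
    then show ?thesis using E AB by algebra
  qed
  moreover have "B * (C - A) \<noteq> 0"
    using theta_nonzero[of "-1" 2 2] theta_nonzero[of 1 24 8] unfolding CA B_def D_def by simp
  ultimately show ?thesis unfolding A_def[symmetric] B_def[symmetric] using mult_left_cancel by blast
qed

section \<open>From the one-sided recursion to two-sided theta series\<close>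

lemma gser_symmetric:
  fixes e :: "int \<Rightarrow> int"
  assumes "graded UNIV e" "\<And>j. e (- j) = e j" "\<And>j. w (- j) = w j" "e 0 = 0" "w 0 = 1"
  shows "gser UNIV w e = 1 + 2 * gser {1..} w e"
proof -
  have U: "{0} \<union> ({1..} \<union> {..-1}) = (UNIV :: int set)" by auto
  have "gser UNIV w e = gser {0} w e + gser ({1..} \<union> {..-1}) w e"
    using gser_Un[of "{0}" "{1..} \<union> {..-1}" e w] assms(1) unfolding U by simp
  also have "gser ({1..} \<union> {..-1}) w e = gser {1..} w e + gser {..-1} w e"
    by (rule gser_Un) (auto intro: graded_subset[OF assms(1)])
  also have "gser {..-1} w e = gser {1..} w e"
    by (rule gser_reindex[of uminus]) (auto simp: assms intro!: bij_betw_byWitness[of _ uminus])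
  also have "gser {0} w e = 1" using gser_singleton[of e 0 w] by (simp add: assms)
  finally show ?thesis by simp
qed

theorem theorem6:
  fixes v :: "int \<Rightarrow> int"
  assumes neg: "\<And>n. n < 0 \<Longrightarrow> v n = 0"
    and rec: "\<And>n. n \<ge> 0 \<Longrightarrow>
      v n + (\<Sum>j\<in>{1..n}. (-1) ^ nat j * (v (n - j^2) + v (n - 2 * j^2)))
        = (if n = 0 then 1 else 0)"
  shows "(\<forall>n. n \<ge> 0 \<longrightarrow> even n \<longrightarrow> v n = int (pbar (nat (n div 2))))
    \<and> (\<forall>n. n \<ge> 1 \<longrightarrow> odd n \<longrightarrow> v n = int (pbar_r (nat ((n - 1) div 2))))"
proof -
  define V where "V = Abs_fps (\<lambda>n. v (int n))"
  define w :: "int \<Rightarrow> int" where "w j = (-1) ^ nat \<bar>j\<bar>" for j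
  define Ev where "Ev = fps_compose (Abs_fps (\<lambda>n. int (pbar n))) (fps_X ^ 2)"
  define Od where "Od = fps_compose (Abs_fps (\<lambda>n. int (pbar_r n))) (fps_X ^ 2)"
  \<comment> \<open>The sum of (-1)^j x^(a j^2) over j \<ge> 1; the recursion uses a = 1 and a =
    2.\<close>
  define H where "H a = gser {1..} w (theta_exp a a)" for a
  have theta: "theta (-1) a a = 1 + 2 * H a" if "a = 1 \<or> a = 2" for a
    unfolding H_def w_def
  proof (rule gser_symmetric)
    show "graded UNIV (theta_exp a a)" using that by (auto intro: graded_theta)
  qed (use that in \<open>auto simp: theta_simps\<close>)
  have VH: "fps_nth (V * H a) n = (\<Sum>j\<in>{1..int n}. w j * v (int n - theta_exp a a j))" if "0 < a" for a n
  proof -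
    have g: "graded {1..} (theta_exp a a)" by (rule graded_subset[OF graded_theta]) (use that in auto)
    have ge: "\<bar>j\<bar> \<le> theta_exp a a j" for j using theta_exp_ge that by blast
    have nonneg: "0 \<le> theta_exp a a j" for j using ge[of j] by linarith
    have "fps_nth (V * H a) n = (\<Sum>j | j \<in> {1..} \<and> theta_exp a a j \<le> int n. w j * v (int n - theta_exp a a j))"
      unfolding H_def fps_mult_gser_nth[OF g] V_def
      by (intro sum.cong refl) (use nonneg in \<open>auto simp: nat_le_iff\<close>)
    \<comment> \<open>The recursion runs over all \<open>j\<close> up to \<open>n\<close>; terms
      whose exponent exceeds \<open>n\<close> evaluate \<open>v\<close> at a negative argument and
      vanish by \<open>neg\<close>.\<close>
    also have "\<dots> = (\<Sum>j\<in>{1..int n}. w j * v (int n - theta_exp a a j))"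
    proof (rule sum.mono_neutral_left)
      have "j \<le> int n" if "theta_exp a a j \<le> int n" for j using ge[of j] that by linarith
      then show "{j. j \<in> {1..} \<and> theta_exp a a j \<le> int n} \<subseteq> {1..int n}" by auto
      show "\<forall>j\<in>{1..int n} - {j. j \<in> {1..} \<and> theta_exp a a j \<le> int n}. w j * v (int n - theta_exp a a j) = 0"
      proof
        fix j assume "j \<in> {1..int n} - {j. j \<in> {1..} \<and> theta_exp a a j \<le> int n}"
        then have "int n - theta_exp a a j < 0" by auto
        then show "w j * v (int n - theta_exp a a j) = 0" by (simp add: neg)
      qed
    qed simp
    finally show ?thesis .
  qed
  have "V * (1 + H 1 + H 2) = 1"
  proof (rule fps_ext)
    fix n
    have "fps_nth (V * (1 + H 1 + H 2)) n = v (int n) + (fps_nth (V * H 1) n + fps_nth (V * H 2) n)"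
      by (simp add: algebra_simps V_def)
    also have "\<dots> = v (int n) + (\<Sum>j\<in>{1..int n}. (-1) ^ nat j * (v (int n - j^2) + v (int n - 2 * j^2)))"
      by (simp add: VH w_def theta_exp_1_1[simplified] theta_exp_2_2 power2_eq_square distrib_left flip: sum.distrib)
    also have "\<dots> = fps_nth 1 n" by (simp add: rec)
    finally show "fps_nth (V * (1 + H 1 + H 2)) n = fps_nth 1 n" .
  qed
  \<comment> \<open>By \<open>theta\<close>, \<phi>(-x) + \<phi>(-x^2) = 2 (1 + H 1 + H 2), so
    \<open>V\<close> and \<open>Ev + fps_X * Od\<close> invert the same series and coincide.\<close>
  moreover have "(Ev + fps_X * Od) * (2 * (1 + H 1 + H 2)) = 2"
    using even_odd_gf_mult_theta unfolding Ev_def[symmetric] Od_def[symmetric] theta[OF disjI1[OF refl]] theta[OF disjI2[OF refl]]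
    by (simp add: algebra_simps)
  ultimately have "2 * V = 2 * (Ev + fps_X * Od)" by algebra
  then have V: "V = Ev + fps_X * Od" by (metis mult_left_cancel zero_neq_numeral)
  have v: "v (int n) = fps_nth Ev n + (if n = 0 then 0 else fps_nth Od (n - 1))" for n
    using arg_cong[OF V, of "\<lambda>f. fps_nth f n"] by (simp add: V_def)
  show ?thesis
  proof (intro conjI allI impI)
    fix n :: int assume "n \<ge> 0" "even n"
    then have "n = int (2 * nat (n div 2))" by simp
    then show "v n = int (pbar (nat (n div 2)))"
      using v[of "2 * nat (n div 2)"] by (simp add: Ev_def Od_def fps_nth_compose_X2)
  next
    fix n :: int assume "n \<ge> 1" "odd n"
    then have "n = int (Suc (2 * nat ((n - 1) div 2)))" by (simp add: nat_eq_iff)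
    then show "v n = int (pbar_r (nat ((n - 1) div 2)))"
      using v[of "Suc (2 * nat ((n - 1) div 2))"] by (simp add: Ev_def Od_def fps_nth_compose_X2)
  qed
qed

end
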